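(* Let $\ell, m, n$ be integers with $\ell \geq 2$, $m \geq 3$, $n \geq 4$ and $m < 4n$. Then \[ F_\ell = [F_m^{-1} \bmod F_n] \] if and only if one of the following holds: (c1) $\ell = n - \tfrac12\big(3 + (-1)^n\big)$ and $m = n-2$; or (c2) $\ell = n - \tfrac12\big(3 - (-1)^n\big)$ and $m \in \{n-1, n+1, n+2\}$; or (c3) $\ell = 2$, $m = 2n-2$, and $n$ is odd; or (c4) $\ell = 2$, $m \in \{2n-1, 2n+1, 2n+2\}$, and $n$ is even; or (c5) $\ell = n-2$ and $m = 3n-2$; or (c6) $\ell = n-1$ and $m \in \{3n-1, 3n+1, 3n+2\}$; or (c7) $\ell = 2$ and $m = 4n-1$.
   Context: $(F_n)_{n\ge1}$ is the Fibonacci sequence: $F_1 = F_2 = 1$ and $F_n = F_{n-1} + F_{n-2}$ for $n \geq 3$. For integers $a$ and $b \geq 1$ with $\gcd(a,b)=1$, $[a^{-1} \bmod b]$ denotes the unique $x \in \{0,1,\dots,b-1\}$ with $ax \equiv 1 \pmod b$; if $\gcd(a,b) > 1$, one sets $[a^{-1} \bmod b] := \infty$ (so in that case it is not equal to any Fibonacci number). *)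

theory Defs
  imports "HOL-Number_Theory.Number_Theory" "HOL-Library.Extended_Nat"
begin

text \<open>
  \<open>inv_mod a b\<close> is $[a^{-1} \bmod b]$ for $b \geq 1$. The library's \<^const>\<open>modular_inverse\<close> returns
  \<open>0\<close> when there is no inverse; here that case has the value \<open>\<infinity>\<close>.
\<close>
definition inv_mod :: "int \<Rightarrow> int \<Rightarrow> enat" where
  "inv_mod a b = (if coprime a b then enat (nat (modular_inverse b a)) else \<infinity>)"

lemma inv_mod_eq_enat_iff:
  assumes "b \<ge> 1"
  shows "inv_mod a b = enat x \<longleftrightarrow> int x \<in> {0..b - 1} \<and> [a * int x = 1] (mod b)"
proof
  assume "inv_mod a b = enat x"
  then have cop: "coprime a b" and x: "x = nat (modular_inverse b a)"
    by (auto simp: inv_mod_def split: if_splits)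
  have "int x = modular_inverse b a"
    using x modular_inverse_int_nonneg[of b a] assms by simp
  then show "int x \<in> {0..b - 1} \<and> [a * int x = 1] (mod b)"
    using cong_modular_inverse1[OF cop] modular_inverse_int_less[of b a] assms by auto
next
  assume x: "int x \<in> {0..b - 1} \<and> [a * int x = 1] (mod b)"
  then have "modular_inverse b a = int x"
    by (intro modular_inverse_int_eqI) auto
  moreover have "coprime a b"
    using x coprime_iff_invertible_int by blast
  ultimately show "inv_mod a b = enat x"
    by (simp add: inv_mod_def)
qed

lemma inv_mod_eq_infinity_iff: "inv_mod a b = \<infinity> \<longleftrightarrow> gcd a b \<noteq> 1"
  by (simp add: inv_mod_def coprime_iff_gcd_eq_1)

end

theory Submission
  imports Defs
begin

text \<open>
  Write $m = qn + r$ with $0 \le r < n$. Modulo $F_n$ one has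
  $F_{qn+r} \equiv F_{n-1}^q F_r$, $F_{n-1}^2 \equiv (-1)^n$ and
  $F_{n-1} F_r \equiv (-1)^{r+1} F_{n-r}$, so every congruence $F_m F_\ell \equiv 1$ turns into
  $F_a F_b \equiv \pm 1$ with $0 < a, b < n$. Reflecting both indices, $a \mapsto n - a$ and
  $b \mapsto n - b$, only changes the sign, so one may assume $a + b \le n$. Then
  $F_a F_b \le F_{n-1} < F_n - 1$ for $n \ge 5$, which forces $F_a F_b = 1$.
\<close>

section \<open>Shifts and reflections of indices modulo a Fibonacci number\<close>

text \<open>In F_(n+j) = F_n F_(j+1) + F_(n-1) F_j the first summand vanishes modulo F_n, so each
  shift by n multiplies by F_(n-1). Writing n as \<open>Suc k\<close> avoids truncated
  subtraction.\<close>

lemma cong_fib_mult_add: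
  "[int (fib (q * Suc k + r)) = int (fib k) ^ q * int (fib r)] (mod int (fib (Suc k)))"
proof (induction q)
  case 0
  then show ?case by simp
next
  case (Suc q)
  define j where "j = q * Suc k + r"
  have "Suc q * Suc k + r = Suc (k + j)"
    by (simp add: j_def)
  then have "int (fib (Suc q * Suc k + r)) =
      int (fib k) * int (fib j) + int (fib (Suc k)) * int (fib (Suc j))"
    by (simp only: fib_add) (simp add: algebra_simps)
  also have "[\<dots> = int (fib k) * int (fib j) + 0] (mod int (fib (Suc k)))"
    by (intro cong_add cong_refl) (simp add: cong_0_iff)
  also have "[int (fib k) * int (fib j) + 0 = int (fib k) * (int (fib k) ^ q * int (fib r))]
      (mod int (fib (Suc k)))"
    using Suc.IH unfolding j_def add_0_right by (rule cong_scalar_left)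
  finally show ?case by (simp only: power_Suc mult.assoc)
qed

text \<open>Cassini's identity: the factor of a single shift squares to a sign. For k = 0 the
  modulus is 1.\<close>

lemma cong_fib_square:
  "[int (fib k) ^ 2 = (-1) ^ Suc k] (mod int (fib (Suc k)))"
proof (cases k)
  case (Suc j)
  have "int (fib k) ^ 2 - (-1) ^ Suc k = int (fib (Suc k)) * int (fib j)"
    using fib_Cassini_int[of j] Suc by simp
  then show ?thesis by (simp add: cong_iff_dvd_diff)
qed simp

text \<open>Both sides satisfy the Fibonacci recurrence in \<open>r\<close> and agree modulo F_(k+1)
  at r = 0 and r = 1; the right side runs the sequence backwards with alternating signs.\<close>

lemma cong_fib_reflect:
  assumes "r \<le> Suc k"
  shows "[int (fib k) * int (fib r) = (-1) ^ Suc r * int (fib (Suc k - r))] (mod int (fib (Suc k)))"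
  using assms
proof (induction r rule: fib.induct)
  case 1
  then show ?case by (simp add: cong_0_iff cong_sym_eq[of 0])
next
  case 2
  then show ?case by simp
next
  case (3 r)
  have step: "int (fib (Suc k - r)) =
      int (fib (Suc k - Suc r)) + int (fib (Suc k - Suc (Suc r)))"
  proof -
    have "Suc k - r = Suc (Suc (Suc k - Suc (Suc r)))" "Suc k - Suc r = Suc (Suc k - Suc (Suc r))"
      using 3(3) by auto
    then show ?thesis by simp
  qed
  have "[int (fib k) * int (fib (Suc r)) + int (fib k) * int (fib r) =
      (-1) ^ Suc (Suc r) * int (fib (Suc k - Suc r)) + (-1) ^ Suc r * int (fib (Suc k - r))]
      (mod int (fib (Suc k)))"
    using 3 by (intro cong_add) auto
  then show ?case
    unfolding step by (simp add: algebra_simps)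
qed

text \<open>Since F_(n-1) squares to a sign, multiplying by its square costs only that sign and
  supplies one factor F_(n-1) to reflect each index.\<close>

lemma cong_fib_mult_reflect:
  assumes "a \<le> n" "b \<le> n" "n > 0"
  shows "[int (fib a) * int (fib b) =
    (-1) ^ (n + a + b) * (int (fib (n - a)) * int (fib (n - b)))] (mod int (fib n))"
proof -
  obtain k where n: "n = Suc k" using assms(3) by (cases n) auto
  define x where "x = int (fib k)"
  have sq: "[x ^ 2 = (-1) ^ n] (mod int (fib n))"
    unfolding n x_def by (rule cong_fib_square)
  \<comment> \<open>The sign is inserted twice, so it cancels; the inner copy is then exchanged for
    \<open>x ^ 2\<close>.\<close>
  have "int (fib a) * int (fib b) = (-1) ^ n * ((-1) ^ n * (int (fib a) * int (fib b)))"
    by (simp flip: mult.assoc power_add)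
  also have "[(-1) ^ n * ((-1) ^ n * (int (fib a) * int (fib b))) =
      (-1) ^ n * (x ^ 2 * (int (fib a) * int (fib b)))] (mod int (fib n))"
    by (intro cong_scalar_left cong_scalar_right cong_sym[OF sq])
  also have "(-1) ^ n * (x ^ 2 * (int (fib a) * int (fib b))) =
      (-1) ^ n * ((x * int (fib a)) * (x * int (fib b)))"
    by (simp add: power2_eq_square algebra_simps)
  also have "[\<dots> = (-1) ^ n * (((-1) ^ Suc a * int (fib (n - a))) *
      ((-1) ^ Suc b * int (fib (n - b))))] (mod int (fib n))"
    using assms unfolding n x_def by (intro cong_scalar_left cong_mult cong_fib_reflect) auto
  finally show ?thesis by (simp add: power_add algebra_simps)
qed

section \<open>Products of two Fibonacci numbers congruent to 1 or -1\<close>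

lemma fib_eq_1_iff: "fib a = 1 \<longleftrightarrow> a = 1 \<or> a = 2"
proof -
  have "fib a \<ge> 2" if "a \<ge> 3"
    using fib_mono[OF that] by (simp add: eval_nat_numeral)
  moreover have "a = 0 \<or> a = 1 \<or> a = 2 \<or> a \<ge> 3" by linarith
  ultimately show ?thesis by auto
qed

lemma fib_mult_le: "fib (Suc a) * fib (Suc b) \<le> fib (Suc (a + b))"
  using fib_add[of a b] by (simp add: mult.commute)

text \<open>The product lies between 1 and F_n - 2, so it is congruent to 1 only when equal to 1,
  and never to -1.\<close>

lemma cong_fib_mult_small_iff:
  assumes "n \<ge> 5" "a \<ge> 1" "b \<ge> 1" "a + b \<le> n" and s: "s = 1 \<or> s = -1"
  shows "[int (fib a) * int (fib b) = s] (mod int (fib n)) \<longleftrightarrow> a \<le> 2 \<and> b \<le> 2 \<and> s = 1"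
proof -
  define P where "P = fib a * fib b"
  have "P \<ge> 1"
    unfolding P_def using assms(2,3) by (simp add: fib_neq_0_nat Suc_le_eq)
  have "P \<le> fib (n - 1)"
  proof -
    have "P \<le> fib (Suc (a - 1 + (b - 1)))"
      using fib_mult_le[of "a - 1" "b - 1"] assms unfolding P_def by simp
    also have "\<dots> \<le> fib (n - 1)"
      using assms by (intro fib_mono) auto
    finally show ?thesis .
  qed
  moreover have "fib (n - 1) + 2 \<le> fib n"
  proof -
    have "n = Suc (Suc (n - 2))" "n - 1 = Suc (n - 2)"
      using assms(1) by auto
    then have "fib n = fib (n - 1) + fib (n - 2)"
      using fib.simps(3)[of "n - 2"] by metis
    \<comment> \<open>The gap F_(n-2) must be at least F_3 = 2, whence n \<ge> 5; a gap of 1 would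
      not exclude the value F_n - 1, which is congruent to -1.\<close>
    moreover have "fib 3 \<le> fib (n - 2)"
      using assms(1) by (intro fib_mono) auto
    ultimately show ?thesis by (simp add: eval_nat_numeral)
  qed
  ultimately have P: "P + 2 \<le> fib n" by linarith
  have "[int P = s] (mod int (fib n)) \<longleftrightarrow> P = 1 \<and> s = 1"
  proof (cases "s = 1")
    case True
    then show ?thesis
      using cong_less_imp_eq_int[of "int P" "int (fib n)" 1] P by auto
  next
    case False
    then have "s = -1" using s by auto
    moreover have "\<not> int (fib n) dvd int P + 1"
      using P zdvd_not_zless[of "int P + 1" "int (fib n)"] by auto
    ultimately show ?thesis by (auto simp: cong_iff_dvd_diff)
  qed
  moreover have "P = 1 \<longleftrightarrow> a \<le> 2 \<and> b \<le> 2"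
    using assms(2,3) unfolding P_def nat_mult_eq_1_iff fib_eq_1_iff by auto
  ultimately show ?thesis by (simp add: P_def conj_ac)
qed

text \<open>Reflection exchanges the two alternatives: the first has a + b \<le> n, the second a + b
  \<ge> 2n - 4 > n, as n \<ge> 5. So each half of the case split meets only one of them.\<close>

lemma cong_fib_mult_iff:
  assumes n: "n \<ge> 5" and ab: "1 \<le> a" "a < n" "1 \<le> b" "b < n"
  shows "[int (fib a) * int (fib b) = (-1) ^ e] (mod int (fib n)) \<longleftrightarrow>
    a \<le> 2 \<and> b \<le> 2 \<and> even e \<or>
    a \<ge> n - 2 \<and> b \<ge> n - 2 \<and> even (e + n + a + b)"
proof -
  define s :: int where "s = (-1) ^ e"
  have s: "s = 1 \<or> s = -1"
    unfolding s_def by (metis neg_one_even_power neg_one_odd_power)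
  have s1: "s = 1 \<longleftrightarrow> even e"
    by (simp add: s_def minus_one_power_iff)
  show ?thesis
  proof (cases "a + b \<le> n")
    case True
    then show ?thesis
      using cong_fib_mult_small_iff[OF n ab(1,3) True s] n s1 by (auto simp: s_def)
  next
    case False
    define u :: int where "u = (-1) ^ (n + a + b)"
    have u: "u = 1 \<or> u = -1"
      unfolding u_def by (metis neg_one_even_power neg_one_odd_power)
    have us: "u * s = 1 \<longleftrightarrow> even (e + n + a + b)"
      by (auto simp: u_def s_def minus_one_power_iff)
    have refl: "[int (fib a) * int (fib b) = u * (int (fib (n - a)) * int (fib (n - b)))]
        (mod int (fib n))"
      unfolding u_def using ab by (intro cong_fib_mult_reflect) auto
    have "[int (fib a) * int (fib b) = s] (mod int (fib n)) \<longleftrightarrow>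
        [u * (int (fib (n - a)) * int (fib (n - b))) = s] (mod int (fib n))"
      using refl by (meson cong_sym cong_trans)
    \<comment> \<open>As 1 or -1, \<open>u\<close> is its own inverse and can change sides.\<close>
    also have "\<dots> \<longleftrightarrow> [int (fib (n - a)) * int (fib (n - b)) = u * s] (mod int (fib n))"
      using u cong_minus_minus_iff[of "int (fib (n - a)) * int (fib (n - b))" "- s"] by auto
    also have "\<dots> \<longleftrightarrow> n - a \<le> 2 \<and> n - b \<le> 2 \<and> u * s = 1"
      using n ab s u False by (intro cong_fib_mult_small_iff) auto
    finally show ?thesis
      using False n ab us unfolding s_def by auto
  qed
qed

section \<open>The inverse as a congruence with a size bound\<close>

text \<open>The bound selects the reduced representative. The value \<open>\<infinity>\<close> needs
  no case of its own, because the congruence already forces coprimality.\<close>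

lemma fib_eq_inv_mod_iff:
  assumes "n \<ge> 1"
  shows "enat (fib l) = inv_mod (int (fib m)) (int (fib n)) \<longleftrightarrow>
    fib l < fib n \<and> [int (fib m) * int (fib l) = 1] (mod int (fib n))"
proof -
  have "int (fib n) \<ge> 1"
    using fib_neq_0_nat[of n] assms by simp
  from inv_mod_eq_enat_iff[OF this, of "int (fib m)" "fib l"] show ?thesis
    by (auto simp: eq_commute[of "enat _"])
qed

text \<open>Strict growth starts only at index 2, since F_1 = F_2; hence the bound on
  \<open>n\<close>.\<close>

lemma fib_less_iff:
  assumes "n \<ge> 3"
  shows "fib l < fib n \<longleftrightarrow> l < n"
proof
  assume "fib l < fib n"
  then show "l < n" using fib_mono[of n l] by (meson not_le)
next
  assume "l < n"
  then have "fib l \<le> fib (n - 1)" by (intro fib_mono) auto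
  also have "n = Suc (Suc (n - 2))" "n - 1 = Suc (n - 2)"
    using assms by auto
  then have "fib n = fib (n - 1) + fib (n - 2)"
    using fib.simps(3)[of "n - 2"] by metis
  then have "fib (n - 1) < fib n"
    using assms fib_neq_0_nat[of "n - 2"] by simp
  finally show "fib l < fib n" .
qed

section \<open>Removing multiples of n from an index\<close>

text \<open>The 2p shifts pair up, each pair contributing the sign (-1)^n.\<close>

lemma cong_fib_even_shift:
  assumes "n > 0"
  shows "[int (fib (2 * p * n + r)) = (-1) ^ (p * n) * int (fib r)] (mod int (fib n))"
proof -
  obtain k where n: "n = Suc k" using assms by (cases n) auto
  have "[(int (fib k) ^ 2) ^ p * int (fib r) = ((-1) ^ n) ^ p * int (fib r)] (mod int (fib n))"
    unfolding n by (intro cong_scalar_right cong_pow cong_fib_square)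
  then have "[int (fib k) ^ (2 * p) * int (fib r) = (-1) ^ (p * n) * int (fib r)] (mod int (fib n))"
    by (simp add: power_mult mult.commute[of p n])
  with cong_fib_mult_add[of "2 * p" k r] show ?thesis
    unfolding n by (rule cong_trans)
qed

text \<open>After pairing, one factor F_(n-1) is left over; it is absorbed by reflecting
  \<open>r\<close>.\<close>

lemma cong_fib_odd_shift:
  assumes "r \<le> n" "n > 0"
  shows "[int (fib ((2 * p + 1) * n + r)) = (-1) ^ (p * n + r + 1) * int (fib (n - r))]
    (mod int (fib n))"
proof -
  obtain k where n: "n = Suc k" using assms by (cases n) auto
  have 1: "[int (fib (n + r)) = int (fib k) * int (fib r)] (mod int (fib n))"
    using cong_fib_mult_add[of 1 k r] unfolding n by simp
  have 2: "[int (fib k) * int (fib r) = (-1) ^ Suc r * int (fib (n - r))] (mod int (fib n))"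
    using assms unfolding n by (intro cong_fib_reflect)
  have "[int (fib (2 * p * n + (n + r))) = (-1) ^ (p * n) * ((-1) ^ Suc r * int (fib (n - r)))]
      (mod int (fib n))"
    using cong_fib_even_shift[OF assms(2)] cong_scalar_left[OF cong_trans[OF 1 2]]
    by (rule cong_trans)
  then show ?thesis
    by (simp add: power_add algebra_simps)
qed

text \<open>A sign is its own inverse, so it moves to the other side of the congruence.\<close>

lemma cong_signed_mult_iff:
  fixes x y s :: int
  assumes "[x = (-1) ^ e * y] (mod k)"
  shows "[x * z = 1] (mod k) \<longleftrightarrow> [y * z = (-1) ^ e] (mod k)"
proof -
  have "[x * z = 1] (mod k) \<longleftrightarrow> [(-1) ^ e * y * z = 1] (mod k)"
    using cong_scalar_right[OF assms, of z] by (meson cong_sym cong_trans)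
  also have "\<dots> \<longleftrightarrow> [y * z = (-1) ^ e] (mod k)"
    using cong_minus_minus_iff[of "y * z" "-1" k] by (cases "even e") auto
  finally show ?thesis .
qed

section \<open>Classification by quotient and remainder of m modulo n\<close>

theorem theorem1:
  fixes l m n :: nat
  assumes "l \<ge> 2" and "m \<ge> 3" and "n \<ge> 4" and "m < 4 * n"
  shows "enat (fib l) = inv_mod (int (fib m)) (int (fib n)) \<longleftrightarrow>
      (real l = real n - 1 / 2 * (3 + (-1) ^ n) \<and> m = n - 2)
    \<or> (real l = real n - 1 / 2 * (3 - (-1) ^ n) \<and> m \<in> {n - 1, n + 1, n + 2})
    \<or> (l = 2 \<and> m = 2 * n - 2 \<and> odd n)
    \<or> (l = 2 \<and> m \<in> {2 * n - 1, 2 * n + 1, 2 * n + 2} \<and> even n)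
    \<or> (l = n - 2 \<and> m = 3 * n - 2)
    \<or> (l = n - 1 \<and> m \<in> {3 * n - 1, 3 * n + 1, 3 * n + 2})
    \<or> (l = 2 \<and> m = 4 * n - 1)"
proof (cases "n = 4")
  case True
  \<comment> \<open>Here F_4 - F_3 = 1, so the size argument fails; the finitely many pairs with l <
    4 are computed directly.\<close>
  have m: "m = 3 \<or> m = 4 \<or> m = 5 \<or> m = 6 \<or> m = 7 \<or> m = 8 \<or> m = 9 \<or> m = 10 \<or> m = 11 \<or>
      m = 12 \<or> m = 13 \<or> m = 14 \<or> m = 15"
    using assms True by presburger
  have fibs: "fib 3 = 2" "fib 4 = 3" "fib 5 = 5" "fib 6 = 8" "fib 7 = 13" "fib 8 = 21"
      "fib 9 = 34" "fib 10 = 55" "fib 11 = 89" "fib 12 = 144" "fib 13 = 233" "fib 14 = 377"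
      "fib 15 = 610"
    by code_simp+
  show ?thesis
  proof (cases "l < 4")
    case False
    then show ?thesis
      using fib_less_iff[of n l] fib_eq_inv_mod_iff[of n l m] True by auto
  next
    case l: True
    then have "l = 2 \<or> l = 3" using assms by auto
    then show ?thesis
      using fib_eq_inv_mod_iff[of n l m] m True
      by (elim disjE) (simp_all add: cong_def fibs)
  qed
next
  case False
  then have n: "n \<ge> 5" using assms by simp
  \<comment> \<open>The half-integer expressions are 2 or 1 according to the parity of
    \<open>n\<close>.\<close>
  have c1: "real l = real n - 1 / 2 * (3 + (-1) ^ n) \<longleftrightarrow> l = (if even n then n - 2 else n - 1)"
    using n by auto
  have c2: "real l = real n - 1 / 2 * (3 - (-1) ^ n) \<longleftrightarrow> l = (if even n then n - 1 else n - 2)"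
    using n by auto
  show ?thesis
  proof (cases "l < n")
    case False
    then have "\<not> fib l < fib n"
      using fib_less_iff[of n l] n by simp
    then show ?thesis
      unfolding c1 c2 using fib_eq_inv_mod_iff[of n l m] False n by auto
  next
    case l: True
    then have lhs: "enat (fib l) = inv_mod (int (fib m)) (int (fib n)) \<longleftrightarrow>
        [int (fib m) * int (fib l) = 1] (mod int (fib n))"
      using fib_eq_inv_mod_iff[of n l m] fib_less_iff[of n l] n by simp
    define q r where "q = m div n" and "r = m mod n"
    have m: "m = q * n + r" and r: "r < n"
      using n by (simp_all add: q_def r_def)
    have "q < 4"
      using assms by (simp add: q_def less_mult_imp_div_less)
    then have q: "q = 0 \<or> q = 1 \<or> q = 2 \<or> q = 3" by auto
    have even_shift: "[int (fib m) * int (fib l) = 1] (mod int (fib n)) \<longleftrightarrow>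
        r \<le> 2 \<and> l \<le> 2 \<and> even (p * n) \<or>
        r \<ge> n - 2 \<and> l \<ge> n - 2 \<and> even (p * n + n + r + l)"
      if "q = 2 * p" "r > 0" for p
      using cong_signed_mult_iff[OF cong_fib_even_shift[of n p r], of "int (fib l)"]
        cong_fib_mult_iff[of n r l "p * n"] assms n l r m that by simp
    \<comment> \<open>An odd quotient reflects \<open>r\<close> to \<open>n - r\<close>, so small
      and large remainders trade places.\<close>
    have odd_shift: "[int (fib m) * int (fib l) = 1] (mod int (fib n)) \<longleftrightarrow>
        n - r \<le> 2 \<and> l \<le> 2 \<and> even (p * n + r + 1) \<or>
        r \<le> 2 \<and> l \<ge> n - 2 \<and> even (p * n + r + 1 + n + (n - r) + l)"
      if "q = 2 * p + 1" "r > 0" for p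
    proof -
      have "n - r \<ge> n - 2 \<longleftrightarrow> r \<le> 2"
        using r n by auto
      then show ?thesis
        using cong_signed_mult_iff[OF cong_fib_odd_shift[of r n p], of "int (fib l)"]
          cong_fib_mult_iff[of n "n - r" l "p * n + r + 1"] assms n l r m that by simp
    qed
    \<comment> \<open>Uniqueness of division with remainder turns every value of \<open>m\<close> in
      the claim into a pair of values for \<open>q\<close> and \<open>r\<close>.\<close>
    have key: "m = a * n + b \<longleftrightarrow> q = a \<and> r = b" if "b < n" for a b
      using m that by (auto simp: q_def r_def)
    have key': "m = a * n - b \<longleftrightarrow> q = a - 1 \<and> r = n - b" if "a \<ge> 1" "1 \<le> b" "b \<le> n" for a b
    proof -
      have "a * n - b = (a - 1) * n + (n - b)"
        using that by (cases a) auto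
      then show ?thesis using key[of "n - b" "a - 1"] that by simp
    qed
    have m_eq:
      "m = n - 2 \<longleftrightarrow> q = 0 \<and> r = n - 2"
      "m = n - 1 \<longleftrightarrow> q = 0 \<and> r = n - 1"
      "m = n + 1 \<longleftrightarrow> q = 1 \<and> r = 1"
      "m = n + 2 \<longleftrightarrow> q = 1 \<and> r = 2"
      "m = 2 * n - 2 \<longleftrightarrow> q = 1 \<and> r = n - 2"
      "m = 2 * n - 1 \<longleftrightarrow> q = 1 \<and> r = n - 1"
      "m = 2 * n + 1 \<longleftrightarrow> q = 2 \<and> r = 1"
      "m = 2 * n + 2 \<longleftrightarrow> q = 2 \<and> r = 2"
      "m = 3 * n - 2 \<longleftrightarrow> q = 2 \<and> r = n - 2"
      "m = 3 * n - 1 \<longleftrightarrow> q = 2 \<and> r = n - 1"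
      "m = 3 * n + 1 \<longleftrightarrow> q = 3 \<and> r = 1"
      "m = 3 * n + 2 \<longleftrightarrow> q = 3 \<and> r = 2"
      "m = 4 * n - 1 \<longleftrightarrow> q = 3 \<and> r = n - 1"
      using key[of 1 1] key[of 2 1] key[of 1 2] key[of 2 2] key[of 1 3] key[of 2 3]
        key'[of 1 2] key'[of 1 1] key'[of 2 2] key'[of 2 1] key'[of 3 2] key'[of 3 1] key'[of 4 1] n
      by simp_all
    \<comment> \<open>This substitution removes truncated subtraction; as r, l < n, the ranges from
      n - 2 on become the two values k + 3 and k + 4.\<close>
    obtain k where k: "n = k + 5"
      using n by (metis add.commute le_Suc_ex)
    have n_eq: "n - 2 = k + 3" "n - 1 = k + 4" "even n \<longleftrightarrow> odd k"
      using k by auto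
    have bounds: "n - r \<le> 2 \<longleftrightarrow> r = k + 3 \<or> r = k + 4" "k + 3 \<le> r \<longleftrightarrow> r = k + 3 \<or> r = k + 4"
        "k + 3 \<le> l \<longleftrightarrow> l = k + 3 \<or> l = k + 4" "l \<le> 2 \<longleftrightarrow> l = 2"
      using k r l assms by auto
    have r2: "r \<le> 2 \<longleftrightarrow> r = 1 \<or> r = 2" if "r > 0"
      using that by auto
    note rhs = c1 c2 insert_iff empty_iff m_eq
    show ?thesis
    proof (cases "r = 0")
      case True
      \<comment> \<open>Now n divides m, hence F_n divides F_m, and F_m is not invertible modulo F_n
        > 1. No listed \<open>m\<close> is a multiple of n.\<close>
      then have "gcd n m = n"
        using m by simp
      then have "fib n dvd fib m"
        using fib_gcd[of n m] by (metis gcd_dvd2)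
      then have "int (fib n) dvd int (fib m) * int (fib l)"
        by simp
      moreover have "\<not> int (fib n) dvd 1"
        using n fib_less_iff[of n 2] by simp
      ultimately have "\<not> [int (fib m) * int (fib l) = 1] (mod int (fib n))"
        using dvd_diff[of "int (fib n)" "int (fib m) * int (fib l)" "int (fib m) * int (fib l) - 1"]
        by (auto simp: cong_iff_dvd_diff)
      then show ?thesis
        unfolding lhs rhs using True n by simp
    next
      case False
      then have r0: "r > 0" by simp
      from q show ?thesis
      proof (elim disjE)
        assume q: "q = 0"
        then have q': "q = 2 * 0" by simp
        \<comment> \<open>This is where m \<ge> 3 matters: it rules out F_m = 1, leaving the
          reflected alternative with m = n - 2 or m = n - 1.\<close>
        have r_ge: "r \<ge> 3" using m q assms by simp
        show ?thesis
          unfolding lhs even_shift[OF q' r0] rhs unfolding n_eq bounds r2[OF r0]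
          using q k r_ge by (cases "even k"; cases "l = 2"; cases "l = k + 3"; cases "l = k + 4";
              cases "r = k + 3"; cases "r = k + 4"; auto)
      next
        assume q: "q = 1"
        then have q': "q = 2 * 0 + 1" by simp
        \<comment> \<open>Large \<open>r\<close> forces l = 2 and an odd \<open>r\<close>; small
          \<open>r\<close> forces \<open>l\<close> to be the odd one of n - 2 and n - 1.\<close>
        show ?thesis
          unfolding lhs odd_shift[OF q' r0] rhs unfolding n_eq bounds r2[OF r0]
          using q k by (cases "even k"; cases "l = 2"; cases "l = k + 3"; cases "l = k + 4";
              cases "r = k + 3"; cases "r = k + 4"; auto)
      next
        assume q: "q = 2"
        then have q': "q = 2 * 1" by simp
        \<comment> \<open>Small \<open>r\<close> requires l = 2 and even \<open>n\<close>; large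
          \<open>r\<close> requires \<open>r\<close> and \<open>l\<close> of equal parity, hence r =
          l.\<close>
        show ?thesis
          unfolding lhs even_shift[OF q' r0] rhs unfolding n_eq bounds r2[OF r0]
          using q k by (cases "even k"; cases "l = 2"; cases "l = k + 3"; cases "l = k + 4";
              cases "r = k + 3"; cases "r = k + 4"; auto)
      next
        assume q: "q = 3"
        then have q': "q = 2 * 1 + 1" by simp
        \<comment> \<open>Parity leaves r = n - 1 with l = 2, or small \<open>r\<close> with l = n -
          1.\<close>
        show ?thesis
          unfolding lhs odd_shift[OF q' r0] rhs unfolding n_eq bounds r2[OF r0]
          using q k by (cases "even k"; cases "l = 2"; cases "l = k + 3"; cases "l = k + 4";
              cases "r = k + 3"; cases "r = k + 4"; auto)
      qed
    qed
  qed
qed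

end
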